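(* As formal power series in $x$ and $q$, $$ \sum_{n=0}^\infty GF_n(q)x^n=1+\sum_{k=1}^\infty\frac{(-1)^k x^{2k}}{(q;q)_k}\,q^{(5k^2-k)/2}\,(xq;q)_{k-1}\,(1-xq^{2k}). $$
   Context: $(a;q)_k=\prod_{i=0}^{k-1}(1-aq^i)$. Partitions are written with parts in increasing order. A partition $\lambda$ is neighborly if every value occurs as a part at most twice and for every part $\lambda_i$ there is a part $\lambda_j$ with $j\ne i$ and $|\lambda_i-\lambda_j|\le 1$ (the empty partition is neighborly). Write $\lambda=(\mu_1,\mu_2)$ where $\mu_1$ is the set of distinct part values and $\mu_2\subseteq\mu_1$ the set of values occurring twice. The graph $G_\lambda$ has one vertex $v$ for each $v\in\mu_1$ and one additional vertex $v'$ for each $v\in\mu_2$; its edges are $\{v,v+1\}$ whenever $v,v+1\in\mu_1$, and $\{v,v'\}$ for $v\in\mu_2$. Each connected component $c$ of $G_\lambda$ has backbone vertices forming a maximal run $\{k,\dots,n\}$ of consecutive integers in $\mu_1$; let $a_1<\dots<a_s$ be the elements of $\mu_2$ in this run. If $s\ge1$, $SIG(c)=\{a_1-k+1, a_2-a_1+2,\dots,a_s-a_{s-1}+2, n-a_s+1\}$ (multiset); if $s=0$, $SIG(c)=\{n-k\}$. $SIG(G_\lambda)$ is the multiset union over components. A neighborly $\lambda$ is admissible if $SIG(G_\lambda)$ contains no multiple of $3$. For admissible $\lambda$, $\operatorname{sign}(\lambda)=(-1)^{t+s}$, where $t$ is the number of elements of $SIG(G_\lambda)$ (with multiplicity) congruent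 to $1\bmod 3$ and $s$ is the number of parts of $\mu_2$. For $n\ge0$, $GF_n(q)=\sum\operatorname{sign}(\lambda)q^{|\lambda|}$, summed over admissible neighborly partitions $\lambda$ with exactly $n$ parts, where $|\lambda|$ is the sum of the parts; $GF_0(q)=1$. *)

theory Defs
  imports "HOL-Computational_Algebra.Formal_Power_Series" "HOL-Library.Multiset"
begin

definition qpochhammer :: "'a::comm_ring_1 \<Rightarrow> 'a \<Rightarrow> nat \<Rightarrow> 'a" where
  "qpochhammer a q k = (\<Prod>i<k. 1 - a * q ^ i)"

text \<open>A partition is the list of its (positive) parts in weakly increasing order.\<close>

definition is_partition :: "nat list \<Rightarrow> bool" where
  "is_partition l \<longleftrightarrow> sorted l \<and> (\<forall>p\<in>set l. p > 0)"

definition neighborly :: "nat list \<Rightarrow> bool" where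
  "neighborly l \<longleftrightarrow> (\<forall>v. count_list l v \<le> 2) \<and>
     (\<forall>i<length l. \<exists>j<length l. j \<noteq> i \<and> \<bar>int (l ! i) - int (l ! j)\<bar> \<le> 1)"

definition mu1 :: "nat list \<Rightarrow> nat set" where
  "mu1 l = set l"

definition mu2 :: "nat list \<Rightarrow> nat set" where
  "mu2 l = {v. count_list l v = 2}"

text \<open>\<open>Backbone v\<close> is the vertex \<open>v\<close> and \<open>Pendant v\<close> the additional vertex \<open>v'\<close>.\<close>

datatype vertex = Backbone nat | Pendant nat

definition graph_verts :: "nat list \<Rightarrow> vertex set" where
  "graph_verts l = Backbone ` mu1 l \<union> Pendant ` mu2 l"

definition graph_edges :: "nat list \<Rightarrow> vertex set set" where
  "graph_edges l = {{Backbone v, Backbone (v + 1)} | v. v \<in> mu1 l \<and> v + 1 \<in> mu1 l}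
     \<union> {{Backbone v, Pendant v} | v. v \<in> mu2 l}"

definition graph_connected :: "nat list \<Rightarrow> (vertex \<times> vertex) set" where
  "graph_connected l = {(u, w). {u, w} \<in> graph_edges l}\<^sup>*"

definition graph_components :: "nat list \<Rightarrow> vertex set set" where
  "graph_components l =
     {{w \<in> graph_verts l. (u, w) \<in> graph_connected l} | u. u \<in> graph_verts l}"

definition backbone :: "vertex set \<Rightarrow> nat set" where
  "backbone c = {v. Backbone v \<in> c}"

text \<open>
  In the following definition \<open>k \<le> a\<^sub>1 < \<dots> < a\<^sub>s \<le> n\<close>, so the subtractions
  on natural numbers do not truncate.
\<close>

definition SIG_component :: "nat list \<Rightarrow> vertex set \<Rightarrow> nat multiset" where
  "SIG_component l c =
     (let k = Min (backbone c);
          n = Max (backbone c);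
          as = sorted_list_of_set (mu2 l \<inter> backbone c)
      in if as = [] then {#n - k#}
         else {#hd as - k + 1#}
              + mset (map (\<lambda>i. as ! Suc i - as ! i + 2) [0..<length as - 1])
              + {#n - last as + 1#})"

definition SIG :: "nat list \<Rightarrow> nat multiset" where
  "SIG l = (\<Sum>c\<in>graph_components l. SIG_component l c)"

definition admissible :: "nat list \<Rightarrow> bool" where
  "admissible l \<longleftrightarrow> (\<forall>m\<in>#SIG l. \<not> 3 dvd m)"

definition partition_sign :: "nat list \<Rightarrow> rat" where
  "partition_sign l = (-1) ^ (size {#m \<in># SIG l. m mod 3 = 1#} + card (mu2 l))"

definition adm_partitions :: "nat \<Rightarrow> nat \<Rightarrow> nat list set" where
  "adm_partitions n m = {l. is_partition l \<and> neighborly l \<and> admissible l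
                            \<and> length l = n \<and> sum_list l = m}"

lemma finite_adm_partitions: "finite (adm_partitions n m)"
proof (rule finite_subset)
  show "adm_partitions n m \<subseteq> {l. set l \<subseteq> {..m} \<and> length l = n}"
    by (auto simp: adm_partitions_def member_le_sum_list)
  show "finite {l. set l \<subseteq> {..m} \<and> length l = n}"
    by (rule finite_lists_length_eq) simp
qed

text \<open>
  The variable \<open>q\<close> is \<^term>\<open>fps_X :: rat fps\<close>. Series in \<open>x\<close> and \<open>q\<close> are elements of
  \<open>rat fps fps\<close>, where the outer variable is \<open>x\<close>. Rational coefficients are used
  because the library's inverse of a power series needs an inverse of its constant term.
\<close>

definition GF :: "nat \<Rightarrow> rat fps" where
  "GF n = Abs_fps (\<lambda>m. \<Sum>l\<in>adm_partitions n m. partition_sign l)"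

lemma GF_0: "GF 0 = 1"
proof -
  have [simp]: "SIG [] = {#}"
    by (simp add: SIG_def graph_components_def graph_verts_def mu1_def mu2_def)
  have "adm_partitions 0 m = (if m = 0 then {[]} else {})" for m
    by (auto simp: adm_partitions_def is_partition_def neighborly_def admissible_def)
  then show ?thesis
    by (simp add: GF_def fps_eq_iff partition_sign_def mu2_def)
qed

definition var_q :: "rat fps fps" where
  "var_q = fps_const fps_X"

definition var_x :: "rat fps fps" where
  "var_x = fps_X"

definition rhs_summand :: "nat \<Rightarrow> rat fps fps" where
  "rhs_summand k =
     (-1) ^ k * var_x ^ (2 * k)
     * fps_const (1 / qpochhammer fps_X fps_X k)
     * var_q ^ ((5 * k ^ 2 - k) div 2)
     * qpochhammer (var_x * var_q) var_q (k - 1)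
     * (1 - var_x * var_q ^ (2 * k))"

end

theory Submission
  imports Defs
begin

text \<open>The signed generating function is the numerator
  \<open>(\<Prod>i. 1 - x * q ^ i) * (\<Sum>S. x ^ card S * q ^ \<Sum>S)\<close>, where \<open>S\<close> runs over the finite sets of positive
  integers without two consecutive elements: expanding the product, the monomial of \<open>\<lambda>\<close> receives a
  coefficient that factors over the runs of \<open>\<lambda>\<close> and, within a run, over the gaps between repeated
  values, and each gap contributes \<open>0\<close>, \<open>-1\<close> or \<open>1\<close>, up to sign, according to its entry of \<open>SIG\<close> modulo 3.
  Splitting off the part 1 then gives the Rogers--Ramanujan equation
  \<open>F(x) = (1 - xq) F(xq) + xq (1 - xq) (1 - xq\<^sup>2) F(xq\<^sup>2)\<close>, which determines \<open>F\<close> up to its constant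
  term. The partial sums of the right-hand side satisfy it up to a high power of \<open>x\<close>, by
  telescoping as in the Rogers--Selberg proof.\<close>

subsection \<open>Telescoping of the Rogers--Selberg series\<close>

unbundle fps_syntax

text \<open>Under this name the exponent is advanced additively by \<open>half_exponent_Suc\<close>,
  away from truncated subtraction and division.\<close>

definition half_exponent :: "nat \<Rightarrow> nat" where
  "half_exponent k = (5 * k ^ 2 - k) div 2"

lemma half_exponent_0 [simp]: "half_exponent 0 = 0"
  by (simp add: half_exponent_def)

lemma half_exponent_Suc [simp]: "half_exponent (Suc k) = half_exponent k + 5 * k + 2"
proof -
  have "k \<le> 5 * k ^ 2"
    by (simp add: power2_eq_square)
  then have "5 * Suc k ^ 2 - Suc k = (5 * k ^ 2 - k) + 2 * (5 * k + 2)"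
    by (simp add: power2_eq_square algebra_simps)
  then show ?thesis
    unfolding half_exponent_def by simp
qed

lemma qpochhammer_0 [simp]: "qpochhammer a q 0 = 1"
  by (simp add: qpochhammer_def)

lemma qpochhammer_Suc: "qpochhammer a q (Suc k) = qpochhammer a q k * (1 - a * q ^ k)"
  by (simp add: qpochhammer_def)

lemma qpochhammer_Suc_shift: "qpochhammer a q (Suc k) = (1 - a) * qpochhammer (a * q) q k"
  by (simp add: qpochhammer_def prod.lessThan_Suc_shift mult.assoc del: prod.lessThan_Suc)

definition inv_qfact :: "nat \<Rightarrow> rat fps fps" where
  "inv_qfact k = fps_const (1 / qpochhammer fps_X fps_X k)"

lemma inv_qfact_0 [simp]: "inv_qfact 0 = 1"
  by (simp add: inv_qfact_def)

text \<open>The denominators have constant term 1, so they are units and the divisions are exact.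
  The orientation brings index \<open>k\<close> to the denominator of index
  \<open>Suc k\<close>.\<close>

lemma inv_qfact_Suc: "inv_qfact k = inv_qfact (Suc k) * (1 - var_q ^ Suc k)"
proof -
  have unit: "qpochhammer fps_X fps_X j dvd (1 :: rat fps)" for j
    by (induction j) (simp_all add: qpochhammer_Suc)
  have unit': "1 - fps_X ^ Suc k dvd (1 :: rat fps)"
    by simp
  have "(1 :: rat fps) / qpochhammer fps_X fps_X k
      = 1 / qpochhammer fps_X fps_X (Suc k) * (1 - fps_X ^ Suc k)"
    using unit_imp_dvd[OF unit']
    by (simp only: qpochhammer_Suc is_unit_div_mult2_eq[OF unit unit'] dvd_div_mult_self flip: power_Suc)
  then show ?thesis
    by (simp add: inv_qfact_def var_q_def flip: fps_const_power fps_const_sub fps_const_mult)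
qed

text \<open>With a general \<open>y\<close> the series at x, xq and xq^2 are instances of one
  function. Index 0 is set apart because \<open>k - 1\<close> truncates there and
  \<open>rhs_summand 0\<close> would be 1 - x.\<close>

fun summand :: "rat fps fps \<Rightarrow> nat \<Rightarrow> rat fps fps" where
  "summand y 0 = 1"
| "summand y (Suc k) = (-1) ^ Suc k * y ^ (2 * Suc k) * inv_qfact (Suc k)
     * var_q ^ half_exponent (Suc k) * qpochhammer (y * var_q) var_q k * (1 - y * var_q ^ (2 * Suc k))"

lemma rhs_summand_eq: "rhs_summand (Suc k) = summand var_x (Suc k)"
  by (simp add: rhs_summand_def inv_qfact_def half_exponent_def del: half_exponent_Suc)

text \<open>The series of the \<open>aux_summand\<close> is the companion of the Rogers--Selberg series: the two
  series satisfy a pair of first-order relations, whose partial sums telescope.\<close>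

definition aux_summand :: "rat fps fps \<Rightarrow> nat \<Rightarrow> rat fps fps" where
  "aux_summand y k = (-1) ^ k * y ^ (2 * k) * inv_qfact k
     * var_q ^ (half_exponent k - k) * qpochhammer y var_q k * (1 - y ^ 2 * var_q ^ (4 * k))"

lemma half_exponent_ge: "k \<le> half_exponent k"
  by (induction k) auto

text \<open>Writing S and A for the two series, the limit is S(y) = A(yq). The explicit remainder
  makes induction possible and carries the factor \<open>y ^ (2 * Suc N)\<close>.\<close>

lemma sum_summand:
  "(\<Sum>k\<le>N. summand y k) = (\<Sum>k\<le>N. aux_summand (y * var_q) k)
     - (-1) ^ Suc N * y ^ (2 * Suc N) * inv_qfact N * var_q ^ half_exponent (Suc N)
       * qpochhammer (y * var_q) var_q N"
proof (induction N)
  case 0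
  show ?case
    by (simp add: aux_summand_def) algebra
next
  case (Suc N)
  define z where "z = var_q ^ Suc N"
  \<comment> \<open>\<open>c\<close> collects what all terms of index \<open>Suc N\<close> share, so
    the step reduces to a polynomial identity in \<open>y\<close>, \<open>z\<close> and
    \<open>var_q\<close>.\<close>
  define c where "c = (-1) ^ Suc N * y ^ (2 * Suc N) * var_q ^ half_exponent (Suc N)
       * qpochhammer (y * var_q) var_q N * inv_qfact (Suc N)"
  have z2: "var_q ^ (2 * Suc N) = z ^ 2" and z4: "var_q ^ (4 * Suc N) = z ^ 4"
    unfolding z_def by (simp_all only: mult.commute[of _ "Suc N"] power_mult)
  have z: "y * var_q * var_q ^ N = y * z"
    by (simp add: z_def)
  \<comment> \<open>The square of \<open>z\<close> comes from substituting \<open>y * var_q\<close>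
    into \<open>y ^ (2 * Suc N)\<close>; one factor \<open>z\<close> makes up for the lowered
    exponent in \<open>aux_summand\<close>.\<close>
  have e1: "var_q ^ (half_exponent (Suc N) - Suc N) * z ^ 2 = var_q ^ half_exponent (Suc N) * z"
    using half_exponent_ge[of "Suc N"] unfolding z_def
    by (simp add: add.commute del: half_exponent_Suc power_Suc flip: power_mult power_add)
  have e2: "var_q ^ half_exponent (Suc (Suc N)) = var_q ^ half_exponent (Suc N) * z ^ 5 * var_q ^ 2"
    unfolding half_exponent_Suc[of "Suc N"] z_def by (simp only: power_add power_mult mult.commute[of 5])
  have s: "summand y (Suc N) = c * (1 - y * z ^ 2)"
    unfolding summand.simps c_def z2 by (simp only: mult_ac)
  have "aux_summand (y * var_q) (Suc N) = (-1) ^ Suc N * y ^ (2 * Suc N) * inv_qfact (Suc N)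
      * (var_q ^ (half_exponent (Suc N) - Suc N) * z ^ 2) * qpochhammer (y * var_q) var_q N * (1 - y * z)
      * (1 - y ^ 2 * var_q ^ 2 * z ^ 4)"
    unfolding aux_summand_def power_mult_distrib z2 z4 qpochhammer_Suc z by (simp only: mult_ac)
  then have a: "aux_summand (y * var_q) (Suc N) = c * (z * (1 - y * z) * (1 - y ^ 2 * var_q ^ 2 * z ^ 4))"
    unfolding e1 c_def by (simp only: mult_ac)
  have r1: "(-1) ^ Suc N * y ^ (2 * Suc N) * inv_qfact N * var_q ^ half_exponent (Suc N)
       * qpochhammer (y * var_q) var_q N = c * (1 - z)"
    unfolding c_def z_def inv_qfact_Suc[of N] by (simp only: mult_ac)
  have y2: "y ^ (2 * Suc (Suc N)) = y ^ (2 * Suc N) * y ^ 2"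
    by (simp flip: power_add)
  have r2: "(-1) ^ Suc (Suc N) * y ^ (2 * Suc (Suc N)) * inv_qfact (Suc N) * var_q ^ half_exponent (Suc (Suc N))
       * qpochhammer (y * var_q) var_q (Suc N) = - (c * (y ^ 2 * z ^ 5 * var_q ^ 2 * (1 - y * z)))"
    unfolding e2 y2 qpochhammer_Suc[of _ _ N] z c_def power_Suc[of "-1" "Suc N"]
    by (simp only: mult_ac mult_minus_left mult_minus_right mult_1)
  show ?case
    \<comment> \<open>The terms in \<open>z ^ 5\<close> cancel, leaving
      \<open>1 - y * z ^ 2 = z * (1 - y * z) + (1 - z)\<close>.\<close>
    unfolding sum.atMost_Suc Suc.IH s a r1 r2 by algebra
qed

text \<open>The limit is A(y) = (1 - y) S(y) + y (1 - y)(1 - yq) S(yq). Taken at y = xq together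
  with S(x) = A(xq), it gives the functional equation for S.\<close>

lemma sum_aux_summand:
  "(\<Sum>k\<le>N. aux_summand y k) =
     (1 - y) * (\<Sum>k\<le>N. summand y k) + y * (1 - y) * (1 - y * var_q) * (\<Sum>k\<le>N. summand (y * var_q) k)
     - (-1) ^ Suc N * y ^ (2 * Suc N) * inv_qfact N * var_q ^ (half_exponent (Suc N) - Suc N)
       * qpochhammer y var_q (Suc N)"
proof (induction N)
  case 0
  show ?case
    by (simp add: aux_summand_def qpochhammer_Suc) algebra
next
  case (Suc N)
  define z where "z = var_q ^ Suc N"
  define c where "c = (-1) ^ Suc N * y ^ (2 * Suc N) * var_q ^ (half_exponent (Suc N) - Suc N)
       * (1 - y) * qpochhammer (y * var_q) var_q N * inv_qfact (Suc N)"
  have z2: "var_q ^ (2 * Suc N) = z ^ 2" and z4: "var_q ^ (4 * Suc N) = z ^ 4"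
    unfolding z_def by (simp_all only: mult.commute[of _ "Suc N"] power_mult)
  have z: "y * var_q * var_q ^ N = y * z"
    by (simp add: z_def)
  have e1: "var_q ^ half_exponent (Suc N) = var_q ^ (half_exponent (Suc N) - Suc N) * z"
    using half_exponent_ge[of "Suc N"] unfolding z_def
    by (simp del: half_exponent_Suc power_Suc flip: power_add)
  have "half_exponent (Suc (Suc N)) - Suc (Suc N) = (half_exponent (Suc N) - Suc N) + Suc N * 5 + 1"
    using half_exponent_ge[of "Suc N"] unfolding half_exponent_Suc[of "Suc N"] by linarith
  then have e2: "var_q ^ (half_exponent (Suc (Suc N)) - Suc (Suc N))
      = var_q ^ (half_exponent (Suc N) - Suc N) * z ^ 5 * var_q"
    unfolding z_def by (simp only: power_add power_mult power_one_right)
  have s1: "(1 - y) * summand y (Suc N) = c * (z * (1 - y * z ^ 2))"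
    unfolding summand.simps e1 z2 c_def by (simp only: mult_ac)
  \<comment> \<open>Both sides are (yq;q)_{N+1}, with a factor split off at the front or at the
    back.\<close>
  have "(1 - y * var_q) * qpochhammer (y * var_q * var_q) var_q N = qpochhammer (y * var_q) var_q N * (1 - y * z)"
    unfolding z[symmetric] by (metis qpochhammer_Suc qpochhammer_Suc_shift)
  moreover have "y * (1 - y) * (1 - y * var_q) * summand (y * var_q) (Suc N) =
     y * (1 - y) * (-1) ^ Suc N * (y ^ (2 * Suc N) * z ^ 2) * inv_qfact (Suc N) * var_q ^ half_exponent (Suc N)
     * ((1 - y * var_q) * qpochhammer (y * var_q * var_q) var_q N) * (1 - y * var_q * z ^ 2)"
    unfolding summand.simps power_mult_distrib z2 by (simp only: mult_ac)
  ultimately have s2: "y * (1 - y) * (1 - y * var_q) * summand (y * var_q) (Suc N)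
      = c * (y * (z ^ 2 * z) * (1 - y * z) * (1 - y * var_q * z ^ 2))"
    unfolding e1 c_def by (simp only: mult_ac)
  have a: "aux_summand y (Suc N) = c * (1 - y ^ 2 * z ^ 4)"
    unfolding aux_summand_def z4 c_def qpochhammer_Suc_shift by (simp only: mult_ac)
  have r1: "(-1) ^ Suc N * y ^ (2 * Suc N) * inv_qfact N * var_q ^ (half_exponent (Suc N) - Suc N)
       * qpochhammer y var_q (Suc N) = c * (1 - z)"
    unfolding c_def z_def inv_qfact_Suc[of N] qpochhammer_Suc_shift by (simp only: mult_ac)
  have y2: "y ^ (2 * Suc (Suc N)) = y ^ (2 * Suc N) * y ^ 2"
    by (simp flip: power_add)
  have r2: "(-1) ^ Suc (Suc N) * y ^ (2 * Suc (Suc N)) * inv_qfact (Suc N)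
       * var_q ^ (half_exponent (Suc (Suc N)) - Suc (Suc N)) * qpochhammer y var_q (Suc (Suc N))
       = - (c * (y ^ 2 * z ^ 5 * var_q * (1 - y * z)))"
    unfolding e2 y2 qpochhammer_Suc_shift[of y] qpochhammer_Suc[of _ _ N] z c_def power_Suc[of "-1" "Suc N"]
    by (simp only: mult_ac mult_minus_left mult_minus_right mult_1)
  have "c * (1 - y ^ 2 * z ^ 4) = c * (1 - z) + c * (z * (1 - y * z ^ 2))
      + c * (y * (z ^ 2 * z) * (1 - y * z) * (1 - y * var_q * z ^ 2)) + c * (y ^ 2 * z ^ 5 * var_q * (1 - y * z))"
    by algebra
  then show ?case
    unfolding sum.atMost_Suc distrib_left Suc.IH s1 s2 a r1 r2 by simp
qed

section \<open>The substitution x -> xq and uniqueness for the functional equation\<close>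

definition dilate :: "rat fps fps \<Rightarrow> rat fps fps" where
  "dilate F = F oo (var_q * fps_X)"

lemma dilate_nth: "dilate F $ n = fps_X ^ n * F $ n"
  by (simp add: dilate_def var_q_def fps_compose_linear)

lemma dilate_diff: "dilate (F - G) = dilate F - dilate G"
  by (simp add: dilate_def fps_compose_sub_distrib)

lemma dilate_summand: "dilate (summand y k) = summand (dilate y) k"
proof -
  have c: "(var_q * fps_X) $ 0 = 0"
    by simp
  note distribs = fps_compose_mult_distrib[OF c] fps_compose_sub_distrib fps_compose_prod_distrib[OF c]
    fps_compose_power[OF c, symmetric]
  have v: "var_q oo (var_q * fps_X) = var_q" "inv_qfact j oo (var_q * fps_X) = inv_qfact j"
     "(-1) oo (var_q * fps_X) = -1" for j
    unfolding inv_qfact_def by (simp_all add: var_q_def fps_compose_uminus)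
  show ?thesis
    by (cases k) (simp_all only: dilate_def summand.simps qpochhammer_def distribs fps_compose_1 v)
qed

lemma dilate_sum_summand: "dilate (\<Sum>k\<le>N. summand y k) = (\<Sum>k\<le>N. summand (dilate y) k)"
  unfolding dilate_summand[symmetric] by (simp add: dilate_def fps_compose_sum_distrib)

lemma dilate_var_x: "dilate (var_x * var_q ^ j) = var_x * var_q * var_q ^ j"
  by (simp add: dilate_def var_x_def var_q_def fps_compose_mult_distrib fps_const_power)

definition rogers_op :: "rat fps fps \<Rightarrow> rat fps fps" where
  "rogers_op F = (1 - var_x * var_q) * dilate F
     + var_x * var_q * (1 - var_x * var_q) * (1 - var_x * var_q ^ 2) * dilate (dilate F)"

lemma rogers_op_diff: "rogers_op (F - G) = rogers_op F - rogers_op G"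
  by (simp add: rogers_op_def dilate_diff algebra_simps)

text \<open>The coefficient of x^n in \<open>rogers_op D\<close> is q^n times that of
  \<open>D\<close> plus a combination of lower ones, and 1 - q^n is nonzero for n > 0. The bound
  \<open>M\<close> allows for partial sums, which solve the equation only up to a power of
  x.\<close>

lemma rogers_op_zero_unique:
  assumes "D $ 0 = 0" and eq: "\<And>n. n < M \<Longrightarrow> (D - rogers_op D) $ n = 0" and "n < M"
  shows "D $ n = 0"
  using \<open>n < M\<close>
proof (induction n rule: less_induct)
  case (less n)
  show ?case
  proof (cases n)
    case 0
    then show ?thesis using assms by simp
  next
    case (Suc m)
    \<comment> \<open>Apart from the leading \<open>dilate D\<close>, every term of
      \<open>rogers_op D\<close> has a factor x and so involves only coefficients below
      \<open>n\<close>.\<close>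
    define E where "E = var_q * (1 - var_x * var_q) * (1 - var_x * var_q ^ 2)"
    have "dilate D $ i = 0" "dilate (dilate D) $ i = 0" if "i \<le> m" for i
      using less Suc that by (simp_all add: dilate_nth)
    then have "(E * dilate (dilate D) - var_q * dilate D) $ m = 0"
      by (simp add: fps_mult_nth)
    moreover have "rogers_op D = dilate D + fps_X * (E * dilate (dilate D) - var_q * dilate D)"
      by (simp add: rogers_op_def E_def var_x_def algebra_simps)
    ultimately have "rogers_op D $ n = fps_X ^ n * D $ n"
      using Suc by (simp add: dilate_nth)
    then have "(1 - fps_X ^ n) * D $ n = 0"
      using eq[OF less.prems] by (simp add: algebra_simps)
    moreover have "(1 - fps_X ^ n :: rat fps) $ 0 \<noteq> 0"
      using Suc by (simp add: fps_nth_power_0)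
    ultimately show ?thesis
      by (metis fps_zero_nth mult_eq_0_iff)
  qed
qed

lemma rogers_op_sum_summand:
  assumes "n < 2 * Suc N"
  shows "((\<Sum>k\<le>N. summand var_x k) - rogers_op (\<Sum>k\<le>N. summand var_x k)) $ n = 0"
proof -
  define S where "S y = (\<Sum>k\<le>N. summand y k)" for y
  have d: "dilate (S var_x) = S (var_x * var_q)" "dilate (S (var_x * var_q)) = S (var_x * var_q * var_q)"
    using dilate_var_x[of 0] dilate_var_x[of 1] by (simp_all add: S_def dilate_sum_summand)
  obtain R where "S var_x - rogers_op (S var_x) = var_x ^ (2 * Suc N) * R"
  proof
    \<comment> \<open>The witness is minus the sum of the remainders of
      \<open>sum_aux_summand\<close> at xq and \<open>sum_summand\<close> at x, with the power of x
      taken out.\<close>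
    show "S var_x - rogers_op (S var_x) = var_x ^ (2 * Suc N) * (
       - ((-1) ^ Suc N * var_q ^ (2 * Suc N) * inv_qfact N * var_q ^ (half_exponent (Suc N) - Suc N)
       * qpochhammer (var_x * var_q) var_q (Suc N))
       - (-1) ^ Suc N * inv_qfact N * var_q ^ half_exponent (Suc N)
       * qpochhammer (var_x * var_q) var_q N)"
      unfolding rogers_op_def d
      unfolding S_def sum_summand[of var_x] sum_aux_summand[of "var_x * var_q"]
      unfolding power_mult_distrib[of var_x]
      by (simp add: algebra_simps power2_eq_square del: half_exponent_Suc power_Suc)
  qed
  then show ?thesis
    using assms unfolding S_def by (simp only: var_x_def fps_X_power_mult_nth if_True)
qed

text \<open>Convergence is coefficientwise, and the coefficient of x^n is final once
  \<open>N\<close> reaches \<open>n\<close>, since \<open>F\<close> and the partial sum agree below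
  x^(2N+2).\<close>

lemma rogers_selberg_sums:
  assumes "F = rogers_op F" and "F $ 0 = 1"
  shows "(\<lambda>k. rhs_summand (Suc k)) sums (F - 1)"
  unfolding sums_def
proof (rule tendsto_fpsI)
  fix n
  show "\<forall>\<^sub>F N in sequentially. (\<Sum>k<N. rhs_summand (Suc k)) $ n = (F - 1) $ n"
    using eventually_ge_at_top[of n]
  proof eventually_elim
    case (elim N)
    define S where "S = (\<Sum>k\<le>N. summand var_x k)"
    have S: "S = 1 + (\<Sum>k<N. rhs_summand (Suc k))"
      by (simp add: S_def sum.atMost_shift rhs_summand_eq del: summand.simps(2))
    have "(F - S) $ n = 0"
    proof (rule rogers_op_zero_unique)
      show "(F - S) $ 0 = 0"
        by (simp add: S assms(2) fps_sum_nth rhs_summand_def var_x_def mult.assoc)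
      show "(F - S - rogers_op (F - S)) $ m = 0" if "m < 2 * Suc N" for m
        using rogers_op_sum_summand[OF that] assms(1) by (simp add: rogers_op_diff S_def[symmetric])
    qed (use elim in simp)
    then show ?case
      by (simp add: S)
  qed
qed

subsection \<open>The sign as a weighted count of sparse subsets\<close>

text \<open>\<open>scan_weight p l\<close> is the sum of \<open>(-1) ^ (length l - card S)\<close> over the sets \<open>S\<close> of values of \<open>l\<close>
  that contain every repeated value and no two consecutive integers, and that avoid \<open>p\<close>. The value
  \<open>p = 0\<close>, which is not a part, stands for the absence of a constraint.\<close>

fun scan_weight :: "nat \<Rightarrow> nat list \<Rightarrow> rat" where
  "scan_weight p [] = 1"
| "scan_weight p [a] = - 1 + (if a = p then 0 else 1)"
| "scan_weight p (a # b # l) =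
     (if a = b then if a = p then 0 else - scan_weight (Suc a) l
      else - scan_weight 0 (b # l) + (if a = p then 0 else scan_weight (Suc a) (b # l)))"

lemma scan_weight_cong:
  assumes "p \<notin> set l" "p' \<notin> set l"
  shows "scan_weight p l = scan_weight p' l"
  using assms by (cases "(p, l)" rule: scan_weight.cases) auto

lemma scan_weight_Cons:
  assumes "a \<notin> set l" "0 \<notin> set l"
  shows "scan_weight p (a # l) = - scan_weight 0 l + (if a = p then 0 else scan_weight (Suc a) l)"
  using assms by (cases l) auto

lemma scan_weight_map_Suc:
  assumes "0 \<notin> set l"
  shows "scan_weight (Suc p) (map Suc l) = scan_weight p l"
  using assms
proof (induction p l rule: scan_weight.induct)
  case (3 p a b l)
  \<comment> \<open>The recursion passes the neutral value 0, which does not shift along with the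
    list; 1 is equally vacuous because no shifted entry equals 1.\<close>
  have "scan_weight 0 (map Suc (b # l)) = scan_weight (Suc 0) (map Suc (b # l))"
    using 3 by (intro scan_weight_cong) auto
  then show ?case
    using 3 by auto
qed auto

lemma scan_weight_0_map_Suc:
  assumes "0 \<notin> set l"
  shows "scan_weight 0 (map Suc l) = scan_weight 0 l"
  using assms scan_weight_cong[of 0 "map Suc l" 1] scan_weight_map_Suc[of l 0] by auto

text \<open>Across a gap of at least two, no adjacency condition links the blocks, so the subset is
  chosen independently on each, and \<open>p\<close> can only constrain \<open>l1\<close>.\<close>

lemma scan_weight_append:
  assumes "\<forall>x\<in>set l1. \<forall>y\<in>set l2. Suc x < y" "0 \<notin> set l2" "p \<notin> set l2"
  shows "scan_weight p (l1 @ l2) = scan_weight p l1 * scan_weight 0 l2"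
  using assms
proof (induction p l1 rule: scan_weight.induct)
  case (1 p)
  then show ?case
    using scan_weight_cong[of p l2 0] by simp
next
  case (2 p a)
  then have "scan_weight (Suc a) l2 = scan_weight 0 l2"
    by (intro scan_weight_cong) auto
  moreover have "a \<notin> set l2"
    using 2 by auto
  ultimately show ?case
    using 2 by (simp add: scan_weight_Cons)
next
  case (3 p a b l)
  have "Suc a \<notin> set l2"
    using 3 by auto
  then show ?case
    using 3 by (auto simp: algebra_simps)
qed

section \<open>Weights modulo 3 on a single run\<close>

definition sig_factor :: "int \<Rightarrow> rat" where
  "sig_factor m = (if m mod 3 = 0 then 0 else if m mod 3 = 1 then - 1 else 1)"

text \<open>This is the recurrence that the signed count obeys along unrepeated values. Its
  solutions have period 3, which is where residues modulo 3 enter. The argument is an integer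
  because an empty run produces -1.\<close>

lemma sig_factor_sum: "sig_factor m + sig_factor (m + 1) + sig_factor (m + 2) = 0"
proof -
  consider "m mod 3 = 0" | "m mod 3 = 1" | "m mod 3 = 2" by linarith
  then show ?thesis
    by cases (simp_all add: sig_factor_def mod_add_left_eq[of m 3, symmetric])
qed

lemma sig_factor_period: "sig_factor (m + 3) = sig_factor m"
  by (simp add: sig_factor_def)

lemma sig_factor_numeral [simp]:
  "sig_factor 0 = 0" "sig_factor 1 = - 1" "sig_factor 2 = 1" "sig_factor 3 = 0" "sig_factor (- 1) = 1"
  by (simp_all add: sig_factor_def)

text \<open>The contribution of all entries of \<open>SIG\<close> but the first, for a run whose largest value is \<open>e - 1\<close>
  and whose repeated values are listed.\<close>

fun gap_weight :: "nat \<Rightarrow> nat list \<Rightarrow> rat" where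
  "gap_weight e [] = 1"
| "gap_weight e [a] = sig_factor (int e - int a)"
| "gap_weight e (a # b # as) = sig_factor (int b - int a + 2) * gap_weight e (b # as)"

text \<open>Peels a run from the left and, later, removes the parts equal to 1; \<open>j = 0\<close>
  covers the case that \<open>k\<close> does not occur.\<close>

lemma strip_least_part:
  assumes "sorted l" "\<forall>v. count_list l v \<le> 2" "\<forall>x\<in>set l. k \<le> x"
  obtains j l' where "j \<le> 2" "l = replicate j k @ l'" "\<forall>x\<in>set l'. Suc k \<le> x"
    "sorted l'" "\<forall>v. count_list l' v \<le> 2"
proof -
  define j l' where "j = count_list l k" and "l' = filter (\<lambda>x. Suc k \<le> x) l"
  have "l = replicate j k @ l'"
    using assms(1,3) unfolding j_def l'_def
  proof (induction l)
    case (Cons a l)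
    show ?case
    proof (cases "a = k")
      case False
      then have "k < a" using Cons.prems by auto
      then have "\<forall>x\<in>set (a # l). k < x" using Cons.prems by auto
      then show ?thesis
        by (auto simp: count_list_0_iff Suc_le_eq filter_id_conv)
    qed (use Cons in auto)
  qed simp
  moreover have "count_list l' v \<le> 2" for v
    using assms(2) calculation by (metis count_list_append le_add2 le_trans)
  moreover have "sorted l'"
    using assms(1) by (simp add: l'_def sorted_wrt_filter)
  moreover have "j \<le> 2" "\<forall>x\<in>set l'. Suc k \<le> x"
    using assms(2) by (simp_all add: j_def l'_def)
  ultimately show ?thesis
    using that by blast
qed

lemma mu2_subset: "mu2 l \<subseteq> set l"
proof
  fix v
  assume "v \<in> mu2 l"
  then have "count_list l v \<noteq> 0" by (simp add: mu2_def)
  then show "v \<in> set l" by (simp add: count_list_0_iff)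
qed

lemma finite_mu2 [simp]: "finite (mu2 l)"
  using finite_subset[OF mu2_subset] by simp

lemma sorted_list_of_set_insert_least:
  assumes "finite A" "\<forall>x\<in>A. k < x"
  shows "sorted_list_of_set (insert k A) = k # sorted_list_of_set A"
proof -
  have "Min (insert k A) = k"
    using assms by (intro Min_eqI) auto
  moreover have "insert k A - {k} = A"
    using assms by auto
  ultimately show ?thesis
    using assms sorted_list_of_set_nonempty[of "insert k A"] by simp
qed

text \<open>Forbidding \<open>k\<close> acts like a repeated value \<open>k - 1\<close> in front:
  the first entry becomes a_1 - (k-1) + 2, and the pair accounts for the extra sign. The two
  formulas feed each other in an induction on the length of the run, which starts at the empty run
  \<open>k = e\<close>.\<close>

lemma scan_weight_run:
  assumes "sorted l" "\<forall>v. count_list l v \<le> 2" "set l = {k..<e}" "0 < k" "k \<le> e"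
  defines "as \<equiv> sorted_list_of_set (mu2 l)"
  shows "scan_weight 0 l = (- 1) ^ length as *
           (if as = [] then sig_factor (int e - int k - 1)
            else sig_factor (int (hd as) - int k + 1) * gap_weight e as)"
    and "scan_weight k l = - ((- 1) ^ length as *
           (if as = [] then sig_factor (int e - int k + 1)
            else sig_factor (int (hd as) - int k + 3) * gap_weight e as))"
proof -
  let ?d = "\<lambda>l. sorted_list_of_set (mu2 l)"
  have "scan_weight 0 l = (- 1) ^ length (?d l) *
           (if ?d l = [] then sig_factor (int e - int k - 1)
            else sig_factor (int (hd (?d l)) - int k + 1) * gap_weight e (?d l)) \<and>
        scan_weight k l = - ((- 1) ^ length (?d l) *
           (if ?d l = [] then sig_factor (int e - int k + 1)
            else sig_factor (int (hd (?d l)) - int k + 3) * gap_weight e (?d l)))"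
    using assms(1-5)
  proof (induction "e - k" arbitrary: k l)
    case 0
    then have "l = []" "k = e" by auto
    then show ?case by (simp add: mu2_def)
  next
    case (Suc n)
    have "k < e" using Suc.hyps by simp
    obtain j l' where l: "j \<le> 2" "l = replicate j k @ l'" "\<forall>x\<in>set l'. Suc k \<le> x"
        "sorted l'" "\<forall>v. count_list l' v \<le> 2"
      using strip_least_part[OF Suc.prems(1,2), of k] Suc.prems(3) by auto
    have k: "k \<notin> set l'" "0 \<notin> set l'"
      using l(3) by auto
    have "k \<in> set l"
      using Suc.prems(3) \<open>k < e\<close> by simp
    then have "j \<noteq> 0"
      using k by (auto simp: l(2))
    then have "insert k (set l') = {k..<e}"
      using Suc.prems(3) by (simp add: l(2))
    also have "\<dots> = insert k {Suc k..<e}"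
      using \<open>k < e\<close> by auto
    finally have set': "set l' = {Suc k..<e}"
      using k(1) by (simp add: insert_ident)
    have shift: "int e - int (Suc k) - 1 = int e - int k - 2" "int e - int (Suc k) + 1 = int e - int k"
        "x - int (Suc k) + 1 = x - int k" "x - int (Suc k) + 3 = x - int k + 2" for x
      by simp_all
    have IH0: "scan_weight 0 l' = (- 1) ^ length (?d l') *
           (if ?d l' = [] then sig_factor (int e - int k - 2)
            else sig_factor (int (hd (?d l')) - int k) * gap_weight e (?d l'))"
      and IH1: "scan_weight (Suc k) l' = - ((- 1) ^ length (?d l') *
           (if ?d l' = [] then sig_factor (int e - int k)
            else sig_factor (int (hd (?d l')) - int k + 2) * gap_weight e (?d l')))"
      using Suc.hyps(1)[OF _ l(4,5) set'] Suc.hyps(2) \<open>k < e\<close> by (simp_all only: shift)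
    consider "j = 1" | "j = 2"
      using l(1) \<open>j \<noteq> 0\<close> by linarith
    then show ?case
    proof cases
      \<comment> \<open>A single \<open>k\<close> is either left out of the subset or put in, which
        forbids \<open>Suc k\<close>. The two recursive values combine by
        \<open>sig_factor_sum\<close>; if \<open>k\<close> is forbidden only the first survives, and
        period 3 gives the entry its stated form.\<close>
      case 1
      then have l_eq: "l = k # l'" using l by simp
      have "mu2 l = mu2 l'"
        using k by (auto simp: mu2_def l_eq count_list_0_iff)
      show ?thesis
      proof (cases "?d l' = []")
        case True
        define x where "x = int e - int k - 2"
        have "int e - int k = x + 2" "int e - int k - 1 = x + 1" "int e - int k + 1 = x + 3"
          by (simp_all add: x_def)
        then show ?thesis
          unfolding \<open>mu2 l = mu2 l'\<close> unfolding l_eq scan_weight_Cons[OF k]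
          using IH0 IH1 True \<open>0 < k\<close> sig_factor_sum[of x] sig_factor_period[of x]
          by (simp add: x_def[symmetric] add.commute[of _ x])
      next
        case False
        define x where "x = int (hd (?d l')) - int k"
        have "- (c * (sig_factor x * g)) - c * (sig_factor (x + 2) * g) = c * (sig_factor (x + 1) * g)" for c g
          using sig_factor_sum[of x] by algebra
        then show ?thesis
          unfolding \<open>mu2 l = mu2 l'\<close> unfolding l_eq scan_weight_Cons[OF k]
          using IH0 IH1 False \<open>0 < k\<close> by (simp add: sig_factor_period x_def[symmetric])
      qed
    next
      \<comment> \<open>A repeated \<open>k\<close> must be in the subset. Its first entry is 1,
        with factor -1; if \<open>k\<close> is forbidden the entry is 3, with factor 0. The
        prohibition on \<open>Suc k\<close> supplies the next entry through
        \<open>IH1\<close>.\<close>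
      case 2
      then have l_eq: "l = k # k # l'" using l by (simp add: numeral_2_eq_2)
      have "mu2 l = insert k (mu2 l')"
        using k by (auto simp: mu2_def l_eq count_list_0_iff)
      moreover have "\<forall>x\<in>mu2 l'. k < x"
        using mu2_subset[of l'] l(3) by (meson Suc_le_lessD subsetD)
      ultimately have d: "?d l = k # ?d l'"
        by (simp only: sorted_list_of_set_insert_least finite_mu2)
      have "gap_weight e (k # ?d l') = (if ?d l' = [] then sig_factor (int e - int k)
            else sig_factor (int (hd (?d l')) - int k + 2) * gap_weight e (?d l'))"
        by (cases "?d l'") auto
      then show ?thesis
        unfolding d unfolding l_eq using \<open>0 < k\<close> by (simp add: IH1)
    qed
  qed
  then show "scan_weight 0 l = (- 1) ^ length as *
           (if as = [] then sig_factor (int e - int k - 1)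
            else sig_factor (int (hd as) - int k + 1) * gap_weight e as)"
    and "scan_weight k l = - ((- 1) ^ length as *
           (if as = [] then sig_factor (int e - int k + 1)
            else sig_factor (int (hd as) - int k + 3) * gap_weight e as))"
    unfolding as_def by auto
qed


subsection \<open>Components of the graph and runs of values\<close>

lemma rtrancl_Un_separated:
  assumes "R \<subseteq> A \<times> A" "S \<subseteq> B \<times> B" "A \<inter> B = {}" "u \<in> A"
  shows "(u, w) \<in> (R \<union> S)\<^sup>* \<longleftrightarrow> (u, w) \<in> R\<^sup>*"
proof
  assume "(u, w) \<in> (R \<union> S)\<^sup>*"
  then have "w \<in> A \<and> (u, w) \<in> R\<^sup>*"
  proof induction
    case (step v w)
    then have "(v, w) \<in> R" using assms by auto
    then show ?case using step assms by (auto intro: rtrancl_into_rtrancl)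
  qed (use assms in auto)
  then show "(u, w) \<in> R\<^sup>*" ..
qed (auto intro: in_rtrancl_UnI)

lemma finite_graph_components [simp]: "finite (graph_components l)"
  by (simp add: graph_components_def graph_verts_def mu1_def setcompr_eq_image)

lemma component_subset: "c \<in> graph_components l \<Longrightarrow> c \<subseteq> graph_verts l"
  by (auto simp: graph_components_def)

lemma component_nonempty: "c \<in> graph_components l \<Longrightarrow> c \<noteq> {}"
  by (auto simp: graph_components_def graph_connected_def)

lemma backbone_subset: "c \<subseteq> graph_verts l \<Longrightarrow> backbone c \<subseteq> set l"
  by (auto simp: backbone_def graph_verts_def mu1_def)

context
  fixes l1 l2 :: "nat list"
  assumes separated: "\<forall>x\<in>set l1. \<forall>y\<in>set l2. Suc x < y"
begin

lemma mu2_append: "mu2 (l1 @ l2) = mu2 l1 \<union> mu2 l2" "mu2 l1 \<inter> mu2 l2 = {}"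
proof -
  have d: "set l1 \<inter> set l2 = {}"
    using separated by force
  show "mu2 l1 \<inter> mu2 l2 = {}"
    using d mu2_subset[of l1] mu2_subset[of l2] by blast
  show "mu2 (l1 @ l2) = mu2 l1 \<union> mu2 l2"
  proof (rule set_eqI)
    fix v
    have "count_list l1 v = 0 \<or> count_list l2 v = 0"
      using d by (auto simp: count_list_0_iff)
    then show "v \<in> mu2 (l1 @ l2) \<longleftrightarrow> v \<in> mu2 l1 \<union> mu2 l2"
      by (auto simp: mu2_def)
  qed
qed

lemma graph_verts_append:
  "graph_verts (l1 @ l2) = graph_verts l1 \<union> graph_verts l2" "graph_verts l1 \<inter> graph_verts l2 = {}"
proof -
  have "set l1 \<inter> set l2 = {}"
    using separated by force
  then show "graph_verts l1 \<inter> graph_verts l2 = {}"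
    using mu2_append(2) by (auto simp: graph_verts_def mu1_def)
qed (auto simp: graph_verts_def mu1_def mu2_append)

lemma graph_edges_append: "graph_edges (l1 @ l2) = graph_edges l1 \<union> graph_edges l2"
proof -
  have "\<not> (v \<in> set l1 \<and> v + 1 \<in> set l2)" "\<not> (v \<in> set l2 \<and> v + 1 \<in> set l1)" for v
    using separated by (metis Suc_eq_plus1 less_irrefl, metis Suc_eq_plus1 not_less_eq less_SucI less_asym)
  then have "{v. v \<in> set (l1 @ l2) \<and> v + 1 \<in> set (l1 @ l2)}
      = {v. v \<in> set l1 \<and> v + 1 \<in> set l1} \<union> {v. v \<in> set l2 \<and> v + 1 \<in> set l2}"
    unfolding set_append by blast
  moreover have "{v. v \<in> mu2 (l1 @ l2)} = {v. v \<in> mu2 l1} \<union> {v. v \<in> mu2 l2}"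
    unfolding mu2_append by blast
  ultimately show ?thesis
    unfolding graph_edges_def mu1_def setcompr_eq_image by (simp only: image_Un Un_ac)
qed

end

lemma graph_edges_subset: "{(u, w). {u, w} \<in> graph_edges l} \<subseteq> graph_verts l \<times> graph_verts l"
  using mu2_subset[of l] by (auto simp: graph_edges_def graph_verts_def mu1_def doubleton_eq_iff)

text \<open>No edge joins the two blocks, so a path never leaves the block where it starts.\<close>

lemma graph_components_append:
  assumes "\<forall>x\<in>set l1. \<forall>y\<in>set l2. Suc x < y"
  shows "graph_components (l1 @ l2) = graph_components l1 \<union> graph_components l2"
    and "graph_components l1 \<inter> graph_components l2 = {}"
proof -
  note V = graph_verts_append[OF assms] and E = graph_edges_append[OF assms]
  define R where "R l = {(u, w). {u, w} \<in> graph_edges l}" for l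
  have R: "R (l1 @ l2) = R l1 \<union> R l2" "R (l1 @ l2) = R l2 \<union> R l1"
    by (auto simp: R_def E)
  have sub: "R l \<subseteq> graph_verts l \<times> graph_verts l" for l
    unfolding R_def by (rule graph_edges_subset)
  have stays: "w \<in> graph_verts l" if "(u, w) \<in> (R l)\<^sup>*" "u \<in> graph_verts l" for u w l
    using that sub[of l] by (induction rule: rtrancl_induct) auto
  have con: "graph_connected l = (R l)\<^sup>*" for l
    by (simp add: graph_connected_def R_def)
  define f where "f l u = {w \<in> graph_verts l. (u, w) \<in> graph_connected l}" for l u
  have comps: "graph_components l = f l ` graph_verts l" for l
    by (auto simp: graph_components_def f_def)
  have "f (l1 @ l2) u = f l1 u" if "u \<in> graph_verts l1" for u
    using rtrancl_Un_separated[OF sub sub V(2) that] stays[of u _ l1] that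
    by (auto simp: f_def con R(1) V(1))
  moreover have "f (l1 @ l2) u = f l2 u" if "u \<in> graph_verts l2" for u
    using rtrancl_Un_separated[OF sub sub _ that, of l1] V(2) stays[of u _ l2] that
    by (auto simp: f_def con R(2) V(1) Int_commute)
  ultimately show "graph_components (l1 @ l2) = graph_components l1 \<union> graph_components l2"
    unfolding comps V(1) image_Un by (simp cong: image_cong)
  show "graph_components l1 \<inter> graph_components l2 = {}"
  proof (rule ccontr)
    assume "graph_components l1 \<inter> graph_components l2 \<noteq> {}"
    then obtain c where c: "c \<in> graph_components l1" "c \<in> graph_components l2"
      by blast
    then have "c \<subseteq> graph_verts l1 \<inter> graph_verts l2"
      by (simp add: component_subset)
    then show False
      using V(2) component_nonempty[OF c(1)] by simp
  qed
qed

text \<open>\<open>SIG_component\<close> sees the list only through the repeated values on the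
  backbone of the component, and these all come from one block.\<close>

lemma SIG_append:
  assumes "\<forall>x\<in>set l1. \<forall>y\<in>set l2. Suc x < y"
  shows "SIG (l1 @ l2) = SIG l1 + SIG l2"
proof -
  have "set l1 \<inter> set l2 = {}"
    using assms by force
  have "SIG_component (l1 @ l2) c = SIG_component l1 c" if "c \<in> graph_components l1" for c
  proof -
    have "mu2 (l1 @ l2) \<inter> backbone c = mu2 l1 \<inter> backbone c"
      unfolding mu2_append[OF assms] using \<open>set l1 \<inter> set l2 = {}\<close>
        backbone_subset[OF component_subset[OF that]] mu2_subset[of l2] by blast
    then show ?thesis
      by (simp only: SIG_component_def)
  qed
  moreover have "SIG_component (l1 @ l2) c = SIG_component l2 c" if "c \<in> graph_components l2" for c
  proof -
    have "mu2 (l1 @ l2) \<inter> backbone c = mu2 l2 \<inter> backbone c"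
      unfolding mu2_append[OF assms] using \<open>set l1 \<inter> set l2 = {}\<close>
        backbone_subset[OF component_subset[OF that]] mu2_subset[of l1] by blast
    then show ?thesis
      by (simp only: SIG_component_def)
  qed
  ultimately show ?thesis
    unfolding SIG_def graph_components_append(1)[OF assms]
    by (simp add: sum.union_disjoint graph_components_append(2)[OF assms])
qed

text \<open>Every vertex is reachable from \<open>Backbone k\<close>, a pendant one through its own
  backbone vertex, so the graph is connected.\<close>

lemma SIG_run:
  assumes "set l = {k..<e}" "k < e"
  shows "SIG l = SIG_component l (graph_verts l)"
proof -
  have symmetric: "sym (graph_connected l)"
    unfolding graph_connected_def by (intro sym_rtrancl symI) (simp add: insert_commute)
  have edge: "(u, w) \<in> graph_connected l" if "{u, w} \<in> graph_edges l" for u w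
    using that by (auto simp: graph_connected_def)
  have transitive: "trans (graph_connected l)"
    by (simp add: graph_connected_def trans_rtrancl)
  have bb: "(Backbone k, Backbone v) \<in> graph_connected l" if "k \<le> v" "v < e" for v
    using that
  proof (induction v rule: dec_induct)
    case base
    show ?case by (simp add: graph_connected_def)
  next
    case (step v)
    have "{Backbone v, Backbone (Suc v)} \<in> graph_edges l"
      using step assms by (auto simp: graph_edges_def mu1_def)
    then show ?case
      using edge step transitive by (meson Suc_lessD transD)
  qed
  have root: "(Backbone k, w) \<in> graph_connected l" if "w \<in> graph_verts l" for w
  proof (cases w)
    case (Backbone v)
    then show ?thesis using that bb assms by (auto simp: graph_verts_def mu1_def)
  next
    case (Pendant v)
    then have "v \<in> mu2 l" using that by (auto simp: graph_verts_def)
    then have "{Backbone v, Pendant v} \<in> graph_edges l" "k \<le> v" "v < e"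
      using mu2_subset[of l] assms by (auto simp: graph_edges_def)
    then show ?thesis
      using bb edge transitive Pendant by (meson transD)
  qed
  have "(u, w) \<in> graph_connected l" if "u \<in> graph_verts l" "w \<in> graph_verts l" for u w
    using root[OF that(1)] root[OF that(2)] symmetric transitive by (meson symD transD)
  moreover have "Backbone k \<in> graph_verts l"
    using assms by (auto simp: graph_verts_def mu1_def)
  ultimately have "graph_components l = {graph_verts l}"
    unfolding graph_components_def by blast
  then show ?thesis
    by (simp add: SIG_def)
qed

section \<open>From the entries of \<open>SIG\<close> to the sign\<close>

definition sig_weight :: "nat list \<Rightarrow> rat" where
  "sig_weight l = (- 1) ^ card (mu2 l) * (\<Prod>m\<in>#SIG l. sig_factor (int m))"

lemma sig_weight_append:
  assumes "\<forall>x\<in>set l1. \<forall>y\<in>set l2. Suc x < y"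
  shows "sig_weight (l1 @ l2) = sig_weight l1 * sig_weight l2"
  unfolding sig_weight_def SIG_append[OF assms] mu2_append[OF assms]
  by (simp add: card_Un_disjoint mu2_append(2)[OF assms] power_add)

text \<open>Turns the indexed form of \<open>SIG_component\<close> into the recursion of
  \<open>gap_weight\<close>. As \<open>e\<close> is one more than the largest value n, the last
  entry n - a_s + 1 is e - a_s.\<close>

lemma prod_gaps:
  assumes "sorted as" "as \<noteq> []"
  shows "(\<Prod>m\<in>#mset (map (\<lambda>i. as ! Suc i - as ! i + 2) [0..<length as - 1]). sig_factor (int m))
    * sig_factor (int e - int (last as)) = gap_weight e as"
  using assms
proof (induction e as rule: gap_weight.induct)
  case (3 e a b as)
  have "map (\<lambda>i. (a # b # as) ! Suc i - (a # b # as) ! i + 2) [0..<length (a # b # as) - 1] =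
    (b - a + 2) # map (\<lambda>i. (b # as) ! Suc i - (b # as) ! i + 2) [0..<length (b # as) - 1]"
    by (simp add: upt_conv_Cons map_Suc_upt[symmetric] del: upt_Suc)
  moreover have "int (b - a + 2) = int b - int a + 2"
    using "3.prems" by simp
  moreover have "(\<Prod>m\<in>#mset (map (\<lambda>i. (b # as) ! Suc i - (b # as) ! i + 2) [0..<length (b # as) - 1]).
      sig_factor (int m)) * sig_factor (int e - int (last (b # as))) = gap_weight e (b # as)"
    using "3.IH" "3.prems" by simp
  ultimately show ?case
    by (simp only: mset.simps image_mset_add_mset prod_mset.add_mset gap_weight.simps last_ConsR
        list.distinct not_False_eq_True mult.assoc)
qed simp_all

lemma sig_weight_run:
  assumes "sorted l" "\<forall>v. count_list l v \<le> 2" "set l = {k..<e}" "0 < k" "k < e"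
  shows "scan_weight 0 l = sig_weight l"
proof -
  define as where "as = sorted_list_of_set (mu2 l)"
  have bb: "backbone (graph_verts l) = {k..<e}"
    using assms(3) by (auto simp: backbone_def graph_verts_def mu1_def)
  have mm: "Min {k..<e} = k" "Max {k..<e} = e - 1"
    using assms(5) by (auto intro!: Min_eqI Max_eqI)
  have "mu2 l \<inter> {k..<e} = mu2 l"
    using mu2_subset[of l] assms(3) by auto
  then have SIG: "SIG l = (if as = [] then {#e - 1 - k#}
         else {#hd as - k + 1#}
              + mset (map (\<lambda>i. as ! Suc i - as ! i + 2) [0..<length as - 1])
              + {#e - 1 - last as + 1#})"
    unfolding SIG_run[OF assms(3,5)] SIG_component_def bb mm as_def by (simp add: Let_def)
  have len: "length as = card (mu2 l)"
    by (simp add: as_def)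
  show ?thesis
  proof (cases "as = []")
    case True
    then show ?thesis
      using assms scan_weight_run(1)[of l k e] len unfolding sig_weight_def SIG as_def[symmetric]
      by (simp add: algebra_simps)
  next
    case False
    have "set as \<subseteq> {k..<e}"
      using mu2_subset[of l] assms(3) by (simp add: as_def)
    then have b: "last as < e" "k \<le> hd as"
      using last_in_set[OF False] hd_in_set[OF False] by auto
    have 1: "int (e - 1 - last as + 1) = int e - int (last as)" "int (hd as - k + 1) = int (hd as) - int k + 1"
      using b by auto
    have "sorted as"
      by (simp add: as_def)
    have "(\<Prod>m\<in>#SIG l. sig_factor (int m)) = sig_factor (int (hd as) - int k + 1) * gap_weight e as"
      unfolding prod_gaps[OF \<open>sorted as\<close> False, symmetric] SIG if_not_P[OF False]
      by (simp only: 1 image_mset_union prod_mset_Un image_mset_single prod_mset_singleton mult.assoc)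
    then show ?thesis
      using assms scan_weight_run(1)[of l k e] False len unfolding as_def[symmetric] sig_weight_def by simp
  qed
qed

lemma split_first_run:
  assumes "sorted l" "l \<noteq> []"
  obtains l1 l2 k e where "l = l1 @ l2" "set l1 = {k..<e}" "k < e" "\<forall>x\<in>set l1. \<forall>y\<in>set l2. Suc x < y"
proof -
  define k where "k = hd l"
  \<comment> \<open>As \<open>e\<close> is the first missing value, parts before the cut are below
    \<open>e\<close> and parts after it above \<open>e\<close>, which leaves a gap of at least
    two.\<close>
  define e where "e = (LEAST x. k \<le> x \<and> x \<notin> set l)"
  have "\<exists>x. x > Max (insert k (set l))" by blast
  then have "\<exists>x. k \<le> x \<and> x \<notin> set l"
    by (metis List.finite_set Max_ge finite_insert insertCI linorder_not_less nless_le)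
  then have e: "k \<le> e" "e \<notin> set l"
    unfolding e_def using LeastI_ex[of "\<lambda>x. k \<le> x \<and> x \<notin> set l"] by auto
  have below: "x \<in> set l" if "k \<le> x" "x < e" for x
    using that not_less_Least[of x "\<lambda>x. k \<le> x \<and> x \<notin> set l"] by (auto simp: e_def)
  have "k \<in> set l" using assms(2) by (simp add: k_def)
  have least: "\<forall>x\<in>set l. k \<le> x"
    using assms by (cases l) (auto simp: k_def)
  have split: "l = filter (\<lambda>x. x < e) l @ filter (\<lambda>x. \<not> x < e) l"
    using assms(1)
  proof (induction l)
    case (Cons a l)
    show ?case
    proof (cases "a < e")
      case False
      then have "\<forall>x\<in>set (a # l). \<not> x < e" using Cons.prems by auto
      then show ?thesis by (simp add: filter_id_conv filter_empty_conv)
    qed (use Cons in auto)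
  qed simp
  show ?thesis
  proof (rule that[OF split, of k e])
    show "set (filter (\<lambda>x. x < e) l) = {k..<e}"
      using least below by auto
    show "k < e"
      using e \<open>k \<in> set l\<close> by (metis nless_le)
    show "\<forall>x\<in>set (filter (\<lambda>x. x < e) l). \<forall>y\<in>set (filter (\<lambda>x. \<not> x < e) l). Suc x < y"
      using e by (auto simp: not_less intro: le_neq_trans less_trans_Suc)
  qed
qed

text \<open>Both sides are multiplicative over separated blocks, so it suffices to compare them on
  single runs.\<close>

lemma scan_weight_eq_sig_weight:
  assumes "sorted l" "\<forall>v. count_list l v \<le> 2" "0 \<notin> set l"
  shows "scan_weight 0 l = sig_weight l"
  using assms
proof (induction l rule: length_induct)
  case (1 l)
  show ?case
  proof (cases "l = []")
    case True
    have "SIG [] = {#}"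
      by (simp add: SIG_def graph_components_def graph_verts_def mu1_def mu2_def)
    then show ?thesis
      using True by (simp add: sig_weight_def mu2_def)
  next
    case False
    then obtain l1 l2 k e where l: "l = l1 @ l2" "set l1 = {k..<e}" "k < e"
        "\<forall>x\<in>set l1. \<forall>y\<in>set l2. Suc x < y"
      using split_first_run[OF \<open>sorted l\<close>] by metis
    have c: "count_list l1 v \<le> 2" "count_list l2 v \<le> 2" for v
      using 1(3) l(1) by (metis count_list_append le_add1 le_trans, metis count_list_append le_add2 le_trans)
    have "0 < k" "l1 \<noteq> []"
      using 1(4) l by (force, force)
    have sorted: "sorted l1" "sorted l2" and z: "0 \<notin> set l2"
      using 1(2,4) by (simp_all add: l(1) sorted_append)
    have "scan_weight 0 l1 = sig_weight l1"
      using c(1) by (intro sig_weight_run[OF sorted(1) _ l(2) \<open>0 < k\<close> l(3)]) simp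
    moreover have "length l2 < length l"
      using \<open>l1 \<noteq> []\<close> by (simp add: l(1))
    then have "scan_weight 0 l2 = sig_weight l2"
      using 1(1) sorted(2) c(2) z by blast
    ultimately show ?thesis
      unfolding l(1) scan_weight_append[OF l(4) z z] sig_weight_append[OF l(4)] by simp
  qed
qed

text \<open>A part without a neighbor is unrepeated and forms a component of one vertex, whose only
  entry is 0, a multiple of 3.\<close>

lemma zero_in_SIG:
  assumes "\<forall>v. count_list l v \<le> 2" "\<not> neighborly l"
  shows "0 \<in># SIG l"
proof -
  obtain i where i: "i < length l" "\<And>j. j < length l \<Longrightarrow> j \<noteq> i \<Longrightarrow> \<not> \<bar>int (l ! i) - int (l ! j)\<bar> \<le> 1"
    using assms unfolding neighborly_def by blast
  define v where "v = l ! i"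
  have "{j. j < length l \<and> v = l ! j} = {i}"
    using i by (force simp: v_def)
  then have "count_list l v = 1"
    by (simp add: count_list_eq_length_filter length_filter_conv_card)
  then have v2: "v \<notin> mu2 l"
    by (simp add: mu2_def)
  have far: "w = v" if "w \<in> set l" "\<bar>int v - int w\<bar> \<le> 1" for w
    using that i by (auto simp: v_def in_set_conv_nth)
  have isolated: "{Backbone v, w} \<notin> graph_edges l" for w
    using v2 far[of "v + 1"] far[of "v - 1"] far[of "Suc v"]
    by (force simp: graph_edges_def mu1_def doubleton_eq_iff)
  have "w = Backbone v" if "(Backbone v, w) \<in> graph_connected l" for w
    using that unfolding graph_connected_def
    by (induction rule: rtrancl_induct) (use isolated in auto)
  moreover have "(Backbone v, Backbone v) \<in> graph_connected l"
    by (simp add: graph_connected_def)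
  moreover have V: "Backbone v \<in> graph_verts l"
    using i(1) by (simp add: graph_verts_def mu1_def v_def)
  ultimately have "{w \<in> graph_verts l. (Backbone v, w) \<in> graph_connected l} = {Backbone v}"
    by blast
  then have "{Backbone v} \<in> graph_components l"
    unfolding graph_components_def using V by blast
  moreover have "backbone {Backbone v} = {v}"
    by (auto simp: backbone_def)
  then have "0 \<in># SIG_component l {Backbone v}"
    using v2 by (simp add: SIG_component_def)
  ultimately show ?thesis
    unfolding SIG_def by (auto simp: set_mset_sum)
qed

text \<open>The zero of \<open>sig_factor\<close> encodes admissibility, and its value -1 at residue
  1 produces the exponent t of the sign.\<close>

lemma prod_sig_factor:
  "(\<Prod>m\<in>#M. sig_factor (int m)) = (if \<forall>m\<in>#M. \<not> 3 dvd m then (- 1) ^ size {#m \<in># M. m mod 3 = 1#} else 0)"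
proof (induction M)
  case (add m M)
  have "int m mod 3 = int (m mod 3)"
    by (simp add: zmod_int)
  then have m: "sig_factor (int m) = (if 3 dvd m then 0 else if m mod 3 = 1 then - 1 else 1)"
    by (auto simp: sig_factor_def dvd_eq_mod_eq_0)
  show ?case
  proof (cases "3 dvd m")
    case False
    then show ?thesis
      by (cases "m mod 3 = 1") (simp_all add: m add.IH)
  qed (simp add: m)
qed simp

lemma scan_weight_eq_sign:
  assumes "sorted l" "\<forall>v. count_list l v \<le> 2" "0 \<notin> set l"
  shows "scan_weight 0 l = (if neighborly l \<and> admissible l then partition_sign l else 0)"
proof -
  have "admissible l \<Longrightarrow> neighborly l"
    using zero_in_SIG[OF assms(2)] by (auto simp: admissible_def)
  then show ?thesis
    unfolding scan_weight_eq_sig_weight[OF assms] sig_weight_def prod_sig_factor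
    by (auto simp: admissible_def partition_sign_def power_add)
qed

subsection \<open>The functional equation\<close>

text \<open>Only the bound on multiplicities is kept, since \<open>scan_weight 0\<close> vanishes on
  whatever is not neighborly and admissible. This larger family is stable under removing the parts 1
  and lowering the others.\<close>

definition thin_partitions :: "nat \<Rightarrow> nat \<Rightarrow> nat list set" where
  "thin_partitions n m =
     {l. sorted l \<and> 0 \<notin> set l \<and> (\<forall>v. count_list l v \<le> 2) \<and> length l = n \<and> sum_list l = m}"

lemma finite_thin_partitions [simp]: "finite (thin_partitions n m)"
proof (rule finite_subset)
  show "thin_partitions n m \<subseteq> {l. set l \<subseteq> {..m} \<and> length l = n}"
    by (auto simp: thin_partitions_def member_le_sum_list)
qed (rule finite_lists_length_eq, simp)

text \<open>Only \<open>p = 0\<close> (no constraint) and \<open>p = 1\<close> (the value 1 is forbidden) are used, and these two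
  families satisfy a closed system of recurrences in \<open>n\<close>.\<close>

definition scan_series :: "nat \<Rightarrow> nat \<Rightarrow> rat fps" where
  "scan_series p n = Abs_fps (\<lambda>m. \<Sum>l\<in>thin_partitions n m. scan_weight p l)"

lemma scan_series_GF: "scan_series 0 n = GF n"
proof (rule fps_ext)
  fix m
  have "adm_partitions n m = {l \<in> thin_partitions n m. neighborly l \<and> admissible l}"
    by (auto simp: adm_partitions_def thin_partitions_def is_partition_def neighborly_def intro: ccontr)
  moreover have "scan_weight 0 l = (if neighborly l \<and> admissible l then partition_sign l else 0)"
    if "l \<in> thin_partitions n m" for l
    using that by (intro scan_weight_eq_sign) (auto simp: thin_partitions_def)
  ultimately show "scan_series 0 n $ m = GF n $ m"
    by (simp add: scan_series_def GF_def sum.inter_filter)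
qed

section \<open>Removing the parts equal to 1\<close>

definition add_ones :: "nat \<Rightarrow> nat list \<Rightarrow> nat list" where
  "add_ones j l = replicate j 1 @ map Suc l"

lemma add_ones_simps [simp]:
  "length (add_ones j l) = j + length l"
  "sum_list (add_ones j l) = j + length l + sum_list l"
  "0 \<notin> set (add_ones j l)"
  "sorted l \<Longrightarrow> sorted (add_ones j l)"
  by (auto simp: add_ones_def sum_list_replicate sum_list_Suc sorted_append sorted_wrt_map)

lemma count_list_add_ones:
  "count_list (add_ones j l) 0 = 0"
  "0 \<notin> set l \<Longrightarrow> count_list (add_ones j l) 1 = j"
  "0 < v \<Longrightarrow> count_list (add_ones j l) (Suc v) = count_list l v"
proof -
  have r: "count_list (replicate j (Suc 0)) v = (if v = Suc 0 then j else 0)" for v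
    by (induction j) auto
  have s: "count_list (map Suc l) (Suc v) = count_list l v" for v
    by (rule count_list_map_conv) simp
  show "count_list (add_ones j l) 0 = 0"
    by (simp add: add_ones_def r)
  show "0 \<notin> set l \<Longrightarrow> count_list (add_ones j l) 1 = j"
    using s[of 0] by (simp add: add_ones_def r count_list_0_iff)
  show "0 < v \<Longrightarrow> count_list (add_ones j l) (Suc v) = count_list l v"
    by (simp add: add_ones_def r s)
qed

text \<open>Lowering all \<open>n\<close> parts by 1 reduces the sum by \<open>n\<close>, and the
  \<open>j\<close> parts equal to 1 disappear.\<close>

lemma bij_betw_add_ones:
  "bij_betw (\<lambda>(j, l). add_ones j l) (SIGMA j:{j. j \<le> 2 \<and> j \<le> n}. thin_partitions (n - j) m)
     (thin_partitions n (n + m))"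
proof (rule bij_betw_imageI)
  show "inj_on (\<lambda>(j, l). add_ones j l) (SIGMA j:{j. j \<le> 2 \<and> j \<le> n}. thin_partitions (n - j) m)"
  proof (rule inj_onI)
    fix x x'
    assume x: "x \<in> (SIGMA j:{j. j \<le> 2 \<and> j \<le> n}. thin_partitions (n - j) m)"
        "x' \<in> (SIGMA j:{j. j \<le> 2 \<and> j \<le> n}. thin_partitions (n - j) m)"
        "(\<lambda>(j, l). add_ones j l) x = (\<lambda>(j, l). add_ones j l) x'"
    obtain j l j' l' where eqs: "x = (j, l)" "x' = (j', l')"
      by (metis prod.exhaust)
    have l: "l \<in> thin_partitions (n - j) m" "l' \<in> thin_partitions (n - j') m"
      and eq: "add_ones j l = add_ones j' l'"
      using x by (simp_all add: eqs)
    then have "j = j'"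
      using count_list_add_ones(2)[of l j] count_list_add_ones(2)[of l' j'] by (simp add: thin_partitions_def)
    then show "x = x'"
      using eq by (simp add: eqs add_ones_def inj_map_eq_map)
  qed
  show "(\<lambda>(j, l). add_ones j l) ` (SIGMA j:{j. j \<le> 2 \<and> j \<le> n}. thin_partitions (n - j) m)
      = thin_partitions n (n + m)"
  proof (intro equalityI subsetI)
    fix l
    assume "l \<in> (\<lambda>(j, l). add_ones j l) ` (SIGMA j:{j. j \<le> 2 \<and> j \<le> n}. thin_partitions (n - j) m)"
    then obtain j l' where l: "l = add_ones j l'" "j \<le> 2" "j \<le> n" "l' \<in> thin_partitions (n - j) m"
      by auto
    have "count_list l v \<le> 2" for v
    proof -
      consider "v = 0" | "v = 1" | u where "v = Suc u" "0 < u"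
        by (metis One_nat_def not0_implies_Suc not_gr_zero)
      then show ?thesis
        using l count_list_add_ones(1)[of j l'] count_list_add_ones(2)[of l' j] count_list_add_ones(3)[of _ j l']
        by cases (auto simp: thin_partitions_def)
    qed
    then show "l \<in> thin_partitions n (n + m)"
      using l by (simp add: thin_partitions_def)
  next
    fix l
    assume l: "l \<in> thin_partitions n (n + m)"
    have "\<forall>x\<in>set l. 1 \<le> x"
      using l by (auto simp: thin_partitions_def Suc_le_eq intro: ccontr)
    then obtain j l1 where l1: "j \<le> 2" "l = replicate j 1 @ l1" "\<forall>x\<in>set l1. Suc 1 \<le> x"
        "sorted l1" "\<forall>v. count_list l1 v \<le> 2"
      using strip_least_part[of l 1] l by (auto simp: thin_partitions_def)
    define l' where "l' = map (\<lambda>x. x - 1) l1"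
    have "map Suc l' = l1"
      unfolding l'_def map_map by (rule map_idI) (use l1(3) in fastforce)
    then have eq: "l = add_ones j l'"
      by (simp add: add_ones_def l1(2))
    have "count_list l' v \<le> 2" for v
      using l1(5) unfolding \<open>map Suc l' = l1\<close>[symmetric] by (metis count_list_map_conv inj_Suc)
    moreover have "0 \<notin> set l'"
      using l1(3) by (auto simp: l'_def)
    moreover have "sorted l'"
      using l1(4) by (simp add: \<open>map Suc l' = l1\<close>[symmetric] sorted_wrt_map)
    moreover have "j + length l' = n" "j + length l' + sum_list l' = n + m"
      using l by (simp_all add: thin_partitions_def eq)
    ultimately have "l' \<in> thin_partitions (n - j) m" "j \<le> n"
      by (auto simp: thin_partitions_def)
    then show "l \<in> (\<lambda>(j, l). add_ones j l) ` (SIGMA j:{j. j \<le> 2 \<and> j \<le> n}. thin_partitions (n - j) m)"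
      using l1(1) eq by (auto intro!: image_eqI[of _ _ "(j, l')"])
  qed
qed

text \<open>If 1 is put in the subset then 2 is forbidden, which after lowering means that 1 is
  forbidden in \<open>l\<close>. A double 1 has to be put in; a single one may also be left out,
  with sign -1.\<close>

lemma scan_weight_add_ones:
  assumes "0 \<notin> set l" "p \<le> 1"
  shows "scan_weight p (add_ones 0 l) = scan_weight 0 l"
    and "scan_weight p (add_ones (Suc 0) l) = - scan_weight 0 l + (if p = 1 then 0 else scan_weight 1 l)"
    and "scan_weight p (add_ones 2 l) = (if p = 1 then 0 else - scan_weight 1 l)"
proof -
  have "p = 0 \<or> p = 1"
    using assms(2) by linarith
  then show "scan_weight p (add_ones 0 l) = scan_weight 0 l"
    using assms(1) scan_weight_map_Suc[of l 0] scan_weight_0_map_Suc[of l] by (auto simp: add_ones_def)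
  have "1 \<notin> set (map Suc l)" "0 \<notin> set (map Suc l)"
    using assms(1) by auto
  then show "scan_weight p (add_ones (Suc 0) l) = - scan_weight 0 l + (if p = 1 then 0 else scan_weight 1 l)"
    using assms(1) scan_weight_map_Suc[of l 1] scan_weight_0_map_Suc[of l]
    by (auto simp: add_ones_def scan_weight_Cons)
  show "scan_weight p (add_ones 2 l) = (if p = 1 then 0 else - scan_weight 1 l)"
    using assms(1) scan_weight_map_Suc[of l 1] by (auto simp: add_ones_def numeral_2_eq_2)
qed

lemma scan_series_rec:
  assumes "p \<le> 1"
  shows "scan_series p n = fps_X ^ n * (scan_series 0 n
     + (if n < 1 then 0 else - scan_series 0 (n - 1) + (if p = 1 then 0 else scan_series 1 (n - 1)))
     + (if n < 2 \<or> p = 1 then 0 else - scan_series 1 (n - 2)))" (is "_ = fps_X ^ n * ?R")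
proof (rule fps_ext)
  fix N
  show "scan_series p n $ N = (fps_X ^ n * ?R) $ N"
  proof (cases "N < n")
    \<comment> \<open>Both sides vanish: \<open>n\<close> positive parts sum to at least
      \<open>n\<close>, and the right-hand side is a multiple of q^n.\<close>
    case True
    have "length l \<le> sum_list l" if "0 \<notin> set l" for l :: "nat list"
      using that by (induction l) auto
    then have "n \<le> N" if "l \<in> thin_partitions n N" for l
      using that by (auto simp: thin_partitions_def)
    then have "thin_partitions n N = {}"
      using True by fastforce
    then show ?thesis
      using True by (simp add: scan_series_def fps_X_power_mult_nth)
  next
    case False
    then obtain m where N: "N = n + m"
      using le_Suc_ex by (metis not_less)
    define g where "g j = (\<Sum>l\<in>thin_partitions (n - j) m. scan_weight p (add_ones j l))" for j
    have "(\<Sum>l\<in>thin_partitions n N. scan_weight p l)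
        = (\<Sum>(j, l)\<in>(SIGMA j:{j. j \<le> 2 \<and> j \<le> n}. thin_partitions (n - j) m). scan_weight p (add_ones j l))"
      unfolding N sum.reindex_bij_betw[OF bij_betw_add_ones, symmetric] by (simp add: case_prod_unfold)
    also have "\<dots> = (\<Sum>j\<in>{j. j \<le> 2 \<and> j \<le> n}. g j)"
      unfolding g_def by (rule sum.Sigma[symmetric]) auto
    also have "{j. j \<le> 2 \<and> j \<le> n} = {j \<in> {0, 1, 2}. j \<le> n}"
      by auto
    also have "(\<Sum>j\<in>\<dots>. g j) = g 0 + (if n < 1 then 0 else g 1) + (if n < 2 then 0 else g 2)"
      by (subst sum.inter_filter) (auto simp: not_le)
    finally have sum: "scan_series p n $ N = g 0 + (if n < 1 then 0 else g 1) + (if n < 2 then 0 else g 2)"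
      by (simp add: scan_series_def)
    have z: "0 \<notin> set l" if "l \<in> thin_partitions k m" for k l
      using that by (simp add: thin_partitions_def)
    have "g 0 = scan_series 0 n $ m"
      unfolding g_def scan_series_def using assms by (simp add: scan_weight_add_ones z)
    moreover have "g 1 = (- scan_series 0 (n - 1) + (if p = 1 then 0 else scan_series 1 (n - 1))) $ m"
      unfolding g_def scan_series_def using assms
      by (simp add: scan_weight_add_ones z sum.distrib sum_negf sum_subtractf)
    moreover have "g 2 = (if p = 1 then 0 else - scan_series 1 (n - 2)) $ m"
      unfolding g_def scan_series_def using assms
      by (simp add: scan_weight_add_ones z sum_negf)
    ultimately show ?thesis
      unfolding sum by (simp add: N fps_X_power_mult_nth)
  qed
qed

text \<open>\<open>G\<close> restricts \<open>F\<close> to subsets avoiding 1. The recurrences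
  become G(x) = (1 - xq) F(xq) and F(x) = G(x) + xq (1 - xq) G(xq), and eliminating \<open>G\<close>
  yields the equation.\<close>

lemma fps_eq_rogers_op_GF: "Abs_fps GF = rogers_op (Abs_fps GF)"
proof -
  define F where "F = Abs_fps (scan_series 0)"
  define G where "G = Abs_fps (scan_series 1)"
  have mult_q: "(var_x * var_q * H) $ n = (if n = 0 then 0 else fps_X * H $ (n - 1))" for H n
    by (cases n) (simp_all add: var_x_def var_q_def mult.assoc)
  have [simp]: "var_x $ 0 = 0" "var_x $ Suc 0 = 1" "var_q $ 0 = fps_X"
    by (simp_all add: var_x_def var_q_def)
  have mult_1_minus_q: "((1 - var_x * var_q) * dilate H) $ n = fps_X ^ n * (H $ n - (if n = 0 then 0 else H $ (n - 1)))"
    for H n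
    by (cases n) (simp_all add: left_diff_distrib mult_q dilate_nth right_diff_distrib mult.assoc[of fps_X])
  have G: "G = (1 - var_x * var_q) * dilate F"
    using scan_series_rec[of 1] by (intro fps_ext) (simp add: mult_1_minus_q F_def G_def)
  have F: "F = G + var_x * var_q * ((1 - var_x * var_q) * dilate G)"
  proof (rule fps_ext)
    fix n
    \<comment> \<open>The three terms belong to a single 1 left out of the subset, a single 1 put
      in, and a double 1. The last two require 1 in the subset and make up the difference of
      \<open>F\<close> and \<open>G\<close>.\<close>
    define a b c where "a = (if n < 1 then 0 else - scan_series 0 (n - 1))"
      and "b = (if n < 1 then 0 else scan_series 1 (n - 1))"
      and "c = (if n < 2 then 0 else - scan_series 1 (n - 2))"
    have "scan_series 0 n = fps_X ^ n * (scan_series 0 n + a + b + c)"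
      by (subst scan_series_rec) (simp_all add: a_def b_def c_def)
    moreover have "scan_series 1 n = fps_X ^ n * (scan_series 0 n + a)"
      by (subst scan_series_rec) (simp_all add: a_def)
    ultimately have S: "scan_series 0 n = scan_series 1 n + fps_X ^ n * (b + c)"
      by (metis add.assoc distrib_left)
    consider "n = 0" | "n = 1" | m where "n = Suc (Suc m)"
      by (metis One_nat_def not0_implies_Suc)
    then have "(var_x * var_q * ((1 - var_x * var_q) * dilate G)) $ n = fps_X ^ n * (b + c)"
      by cases (simp_all add: b_def c_def G_def mult_q mult_1_minus_q dilate_nth mult.assoc[of fps_X])
    then show "F $ n = (G + var_x * var_q * ((1 - var_x * var_q) * dilate G)) $ n"
      using S by (simp add: F_def G_def)
  qed
  have dilate_G: "dilate G = (1 - var_x * var_q ^ 2) * dilate (dilate F)"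
    unfolding G
    by (simp add: dilate_def fps_compose_mult_distrib fps_compose_sub_distrib var_x_def var_q_def
        fps_const_power power2_eq_square mult.assoc)
  have "rogers_op F = (1 - var_x * var_q) * dilate F
      + var_x * var_q * ((1 - var_x * var_q) * ((1 - var_x * var_q ^ 2) * dilate (dilate F)))"
    by (simp only: rogers_op_def mult.assoc)
  then have "F = rogers_op F"
    unfolding dilate_G[symmetric] G[symmetric] F[symmetric] by (rule sym)
  then show ?thesis
    by (simp add: F_def ext[of "scan_series 0" GF, OF scan_series_GF])
qed

theorem theorem4p3:
  shows "summable (\<lambda>k. rhs_summand (Suc k)) \<and>
         Abs_fps GF = 1 + (\<Sum>k. rhs_summand (Suc k))"
proof -
  have "(\<lambda>k. rhs_summand (Suc k)) sums (Abs_fps GF - 1)"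
    using fps_eq_rogers_op_GF by (rule rogers_selberg_sums) (simp add: GF_0)
  then show ?thesis
    by (simp add: sums_iff)
qed

end
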